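(* Let $(X,\mathcal{A},\mathbf{P})$ be a probability space, let $p_0>1$ and $\Delta\ge0$ be constants, and let $S:[1,\infty)\to(0,\infty)$ be continuous and slowly varying at infinity. Then $$ G\psi_{p_0,\Delta,S}\ \subset\ wL\Phi_{p_0,\Delta+1,S}, $$ where $\subset$ denotes linear continuous embedding.
   Context: For a constant $\Theta\ge0$ define the even function $\Phi_{p_0,\Theta,S}$ by $$ \Phi_{p_0,\Theta,S}(u)=\frac{|u|^{p_0}(\log|u|)^{-\Theta}}{S(\log|u|)},\quad |u|\ge e;\qquad \Phi_{p_0,\Theta,S}(u)=C_0\,u^2,\quad |u|\le e, $$ where the constant $C_0>0$ is determined by continuity at $|u|=e$: $C_0e^2=e^{p_0}/S(1)$. In the claim it is used with $\Theta=\Delta+1$. For $1\le p<p_0$ put $$ \psi_{p_0,\Delta,S}(p)=(p_0-p)^{-(1+\Delta)/p_0}\,S^{1/p_0}\!\left(\frac{p_0}{p_0-p}\right). $$ For measurable $f:X\to\mathbb{R}$ let $T_f(t)=\mathbf{P}\{x:|f(x)|\ge t\}$ and $\|f\|_p=\left(\int_X|f|^p\,d\mathbf{P}\right)^{1/p}$. Set - $\|f\|_{wL\Phi}=\inf\{c>0:\sup_{t>0}[\Phi(t/c)T_f(t)]\le1\}$, and $wL\Phi=\{f:\|f\|_{wL\Phi}<\infty\}$ (weak Orlicz space); - $\|f\|_{G\psi}=\sup_{1\le p<p_0}\|f\|_p/\psi(p)$, and $G\psi=\{f:\|f\|_{G\psi}<\infty\}$ for $\psi=\psi_{p_0,\Delta,S}$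 (Grand Lebesgue space). Continuous embedding $Y\subset Z$ of two such spaces means that there is a constant $C<\infty$ with $\|f\|_Z\le C\|f\|_Y$ for all $f\in Y$. *)

theory Defs
  imports "HOL-Probability.Probability"
begin

definition slowly_varying :: "(real \<Rightarrow> real) \<Rightarrow> bool" where
  "slowly_varying S \<longleftrightarrow> (\<forall>c>0. ((\<lambda>x. S (c * x) / S x) \<longlongrightarrow> 1) at_top)"

text \<open>The constant \<open>C\<^sub>0\<close> of \<open>\<Phi>\<close> is the one forced by continuity at \<open>\<bar>u\<bar> = e\<close>; see \<open>Phi_branches_agree\<close>.\<close>

definition Phi_const :: "real \<Rightarrow> (real \<Rightarrow> real) \<Rightarrow> real" where
  "Phi_const p0 S = exp p0 / (S 1 * (exp 1)\<^sup>2)"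

definition Phi :: "real \<Rightarrow> real \<Rightarrow> (real \<Rightarrow> real) \<Rightarrow> real \<Rightarrow> real" where
  "Phi p0 \<Theta> S u =
     (if \<bar>u\<bar> \<ge> exp 1 then \<bar>u\<bar> powr p0 * ln \<bar>u\<bar> powr (- \<Theta>) / S (ln \<bar>u\<bar>)
      else Phi_const p0 S * u\<^sup>2)"

lemma Phi_branches_agree:
  assumes "S 1 > 0" and "\<bar>u\<bar> = exp 1"
  shows "\<bar>u\<bar> powr p0 * ln \<bar>u\<bar> powr (- \<Theta>) / S (ln \<bar>u\<bar>) = Phi_const p0 S * u\<^sup>2"
proof -
  have "u\<^sup>2 = (exp 1)\<^sup>2"
    using assms(2) by (metis power2_abs)
  then show ?thesis
    using assms by (simp add: Phi_const_def powr_def)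
qed

definition psi :: "real \<Rightarrow> real \<Rightarrow> (real \<Rightarrow> real) \<Rightarrow> real \<Rightarrow> real" where
  "psi p0 \<Delta> S p = (p0 - p) powr (- (1 + \<Delta>) / p0) * S (p0 / (p0 - p)) powr (1 / p0)"

text \<open>All norms take values in \<^typ>\<open>ennreal\<close>, so that they are \<open>\<top>\<close> exactly outside the
  corresponding space: \<open>\<top>\<close> is an infinite integral or supremum, or the infimum of the empty set.\<close>

definition Lp_norm :: "'a measure \<Rightarrow> real \<Rightarrow> ('a \<Rightarrow> real) \<Rightarrow> ennreal" where
  "Lp_norm M p f =
     (let I = (\<integral>\<^sup>+ x. ennreal (\<bar>f x\<bar> powr p) \<partial>M)
      in if I = \<top> then \<top> else ennreal (enn2real I powr (1 / p)))"

definition tail :: "'a measure \<Rightarrow> ('a \<Rightarrow> real) \<Rightarrow> real \<Rightarrow> real" where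
  "tail M f t = measure M {x \<in> space M. \<bar>f x\<bar> \<ge> t}"

definition weak_orlicz_norm :: "'a measure \<Rightarrow> (real \<Rightarrow> real) \<Rightarrow> ('a \<Rightarrow> real) \<Rightarrow> ennreal" where
  "weak_orlicz_norm M \<Phi> f =
     (INF c \<in> {c::real. c > 0 \<and> (SUP t \<in> {0<..}. ennreal (\<Phi> (t / c) * tail M f t)) \<le> 1}. ennreal c)"

definition weak_orlicz_space :: "'a measure \<Rightarrow> (real \<Rightarrow> real) \<Rightarrow> ('a \<Rightarrow> real) set" where
  "weak_orlicz_space M \<Phi> = {f \<in> borel_measurable M. weak_orlicz_norm M \<Phi> f < \<top>}"

definition grand_lebesgue_norm ::
    "'a measure \<Rightarrow> real \<Rightarrow> (real \<Rightarrow> real) \<Rightarrow> ('a \<Rightarrow> real) \<Rightarrow> ennreal" where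
  "grand_lebesgue_norm M p0 \<psi> f = (SUP p \<in> {1..<p0}. Lp_norm M p f / ennreal (\<psi> p))"

definition grand_lebesgue_space ::
    "'a measure \<Rightarrow> real \<Rightarrow> (real \<Rightarrow> real) \<Rightarrow> ('a \<Rightarrow> real) set" where
  "grand_lebesgue_space M p0 \<psi> = {f \<in> borel_measurable M. grand_lebesgue_norm M p0 \<psi> f < \<top>}"

definition continuously_embedded ::
    "'b set \<Rightarrow> ('b \<Rightarrow> ennreal) \<Rightarrow> 'b set \<Rightarrow> ('b \<Rightarrow> ennreal) \<Rightarrow> bool" where
  "continuously_embedded Y normY Z normZ \<longleftrightarrow>
     Y \<subseteq> Z \<and> (\<exists>C<\<top>. \<forall>f\<in>Y. normZ f \<le> C * normY f)"

end

(* Chebyshev's inequality bounds the tail of f by (K psi(p) / t)^p for every p < p0, where K bounds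
   the grand Lebesgue norm.  With u = t / c and L = ln u, the choice p = p0 (1 - 1/L) makes
   p0 / (p0 - p) = L, so that Phi(u) (psi(p) / u)^p is at most exp(p0) S(L)^(-1/L).  A slowly varying
   function decays at most exponentially, hence this quantity is bounded.  Since p >= 1, a bound B
   turns into Phi(t/c) T_f(t) <= B (K/c)^p <= 1 for c = max(B, 1) K. *)

theory Submission
  imports Defs
begin

text \<open>Far out, \<open>S (2 * x) / S x\<close> exceeds 1/2, so undoing a doubling of the
  argument costs at most a factor 1/2. Repeated halving leads into a compact interval, where
  continuity gives a positive minimum. Counting halvings linearly in \<open>x\<close> is wasteful
  but gives the exponential rate needed later, where only \<open>S L powr (- 1 / L)\<close> has to
  stay bounded.\<close>

lemma slowly_varying_exp_lower_bound:
  assumes "continuous_on {1..} S" and pos: "\<And>x. x \<ge> 1 \<Longrightarrow> S x > (0::real)"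
    and "slowly_varying S"
  obtains E where "E \<ge> 0" "\<And>x. x \<ge> 1 \<Longrightarrow> exp (- E * x) \<le> S x"
proof -
  have "((\<lambda>x. S (2 * x) / S x) \<longlongrightarrow> 1) at_top"
    using assms(3) by (simp add: slowly_varying_def)
  then have "\<forall>\<^sub>F x in at_top. S (2 * x) / S x > 1 / 2"
    by (rule order_tendstoD) simp
  then obtain x1 where x1: "\<And>x. x \<ge> x1 \<Longrightarrow> S (2 * x) / S x > 1 / 2"
    by (auto simp: eventually_at_top_linorder)
  \<comment> \<open>The maximum with 1 ensures that halving any \<open>x\<close> above
    \<open>2 * x0\<close> keeps it in the domain of \<open>S\<close> and in the range where the
    ratio bound holds.\<close>
  define x0 where "x0 = max x1 1"
  have "continuous_on {1..2 * x0} S"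
    by (rule continuous_on_subset[OF assms(1)]) auto
  moreover have "{1..2 * x0} \<noteq> {}"
    by (simp add: x0_def)
  ultimately obtain y where y: "y \<in> {1..2 * x0}" "\<And>x. x \<in> {1..2 * x0} \<Longrightarrow> S y \<le> S x"
    using continuous_attains_inf[of "{1..2 * x0}" S] by auto
  have m: "S y > 0"
    using pos y(1) by simp
  \<comment> \<open>One halving would allow the range of \<open>x\<close> to double; letting it grow
    only by 1 per factor 1/2 suffices and ties \<open>n\<close> directly to
    \<open>x\<close>.\<close>
  have lower: "S x \<ge> S y / 2 ^ n" if "1 \<le> x" "x \<le> 2 * x0 + real n" for x n
    using that
  proof (induction n arbitrary: x)
    case 0
    then show ?case using y(2) by simp
  next
    case (Suc n)
    show ?case
    proof (cases "x \<le> 2 * x0")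
      case True
      then have "S y \<le> S x"
        using Suc.prems y(2) by simp
      moreover have "S y / 2 ^ Suc n \<le> S y / 1"
        using m by (intro divide_left_mono) (auto simp del: power_Suc)
      ultimately show ?thesis by simp
    next
      case False
      have "x0 \<ge> 1" "x0 \<ge> x1"
        by (auto simp: x0_def)
      with False Suc.prems have x2: "1 \<le> x / 2" "x / 2 \<le> 2 * x0 + real n" "x / 2 \<ge> x1"
        by auto
      have "S y / 2 ^ n \<le> S (x / 2)"
        using Suc.IH x2 by blast
      moreover have "S (x / 2) / 2 < S x"
        using x1[OF x2(3)] pos[OF x2(1)] by (simp add: field_simps)
      ultimately show ?thesis by simp
    qed
  qed
  \<comment> \<open>The first summand pays for the minimum \<open>S y\<close>, the second for the at
    most \<open>2 * x\<close> halvings.\<close>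
  define E where "E = \<bar>ln (S y)\<bar> + 2 * ln 2"
  show thesis
  proof
    show "E \<ge> 0" by (simp add: E_def)
  next
    fix x :: real
    assume x: "x \<ge> 1"
    define n where "n = nat \<lceil>x\<rceil>"
    have n: "x \<le> real n" "real n \<le> 2 * x"
      using x unfolding n_def by linarith+
    have "- E * x = - (\<bar>ln (S y)\<bar> * x) - 2 * x * ln 2"
      by (simp add: E_def algebra_simps)
    also have "\<dots> \<le> - \<bar>ln (S y)\<bar> - real n * ln 2"
      using mult_left_mono[OF x, of "\<bar>ln (S y)\<bar>"] n(2)
      by (intro diff_mono mult_right_mono) auto
    also have "\<dots> \<le> ln (S y) - real n * ln 2"
      by simp
    also have "\<dots> = ln (S y / 2 ^ n)"
      using m by (simp add: ln_div ln_realpow)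
    finally have "exp (- E * x) \<le> S y / 2 ^ n"
      using m by (metis exp_le_cancel_iff exp_ln divide_pos_pos zero_less_power zero_less_numeral)
    also have "\<dots> \<le> S x"
      using lower[of x n] x n(1) by (simp add: x0_def)
    finally show "exp (- E * x) \<le> S x" .
  qed
qed

lemma psi_pos:
  assumes "\<And>x. x \<ge> 1 \<Longrightarrow> S x > 0" and "1 \<le> p" "p < p0"
  shows "psi p0 \<Delta> S p > 0"
proof -
  have "p0 / (p0 - p) \<ge> 1"
    using assms(2,3) by simp
  then show ?thesis
    using assms(1)[of "p0 / (p0 - p)"] assms(3) by (simp add: psi_def)
qed

text \<open>This is Chebyshev's inequality for the power \<open>p\<close> of \<open>f\<close>, with
  \<open>K * \<psi> p\<close> as bound for the \<open>p\<close>-norm. Taking any real upper bound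
  \<open>K\<close> instead of the norm itself later permits a strictly positive \<open>K\<close>
  when the norm is zero.\<close>

lemma tail_le_grand_lebesgue_norm:
  assumes "finite_measure M" and f: "f \<in> borel_measurable M"
    and norm: "grand_lebesgue_norm M p0 \<psi> f \<le> ennreal K" and "K \<ge> 0"
    and p: "p \<in> {1..<p0}" and \<psi>: "\<psi> p > 0" and t: "t > 0"
  shows "tail M f t \<le> (K * \<psi> p / t) powr p"
proof -
  interpret finite_measure M by fact
  define I where "I = (\<integral>\<^sup>+ x. ennreal (\<bar>f x\<bar> powr p) \<partial>M)"
  have "Lp_norm M p f / ennreal (\<psi> p) \<le> ennreal K"
    using norm p unfolding grand_lebesgue_norm_def by (meson SUP_upper order_trans)
  then have "Lp_norm M p f / ennreal (\<psi> p) * ennreal (\<psi> p) \<le> ennreal K * ennreal (\<psi> p)"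
    by (rule mult_right_mono) simp
  then have "Lp_norm M p f \<le> ennreal K * ennreal (\<psi> p)"
    using \<psi> by (simp add: ennreal_divide_times)
  then have Lp: "Lp_norm M p f \<le> ennreal (K * \<psi> p)"
    using \<psi> \<open>K \<ge> 0\<close> by (simp add: ennreal_mult)
  \<comment> \<open>A finite norm bound excludes the infinite branch of \<open>Lp_norm\<close>, so
    \<open>enn2real I\<close> loses nothing.\<close>
  then have "I \<noteq> \<top>"
    unfolding Lp_norm_def I_def[symmetric] by (auto simp: top_unique)
  then have "enn2real I powr (1 / p) \<le> K * \<psi> p"
    using Lp \<psi> \<open>K \<ge> 0\<close> unfolding Lp_norm_def I_def[symmetric] by simp
  then have "(enn2real I powr (1 / p)) powr p \<le> (K * \<psi> p) powr p"
    using p by (intro powr_mono2) auto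
  then have "enn2real I \<le> (K * \<psi> p) powr p"
    using p by (simp add: powr_powr)
  then have I: "I \<le> ennreal ((K * \<psi> p) powr p)"
    using \<open>I \<noteq> \<top>\<close> by (metis ennreal_enn2real ennreal_leI less_top)
  have "ennreal (t powr p) * emeasure M {x \<in> space M. \<bar>f x\<bar> \<ge> t}
      = (\<integral>\<^sup>+ x. ennreal (t powr p) * indicator {x \<in> space M. \<bar>f x\<bar> \<ge> t} x \<partial>M)"
    using f by (intro nn_integral_cmult_indicator[symmetric]) measurable
  also have "\<dots> \<le> I"
    unfolding I_def using p t
    by (intro nn_integral_mono) (auto simp: indicator_def intro!: ennreal_leI powr_mono2)
  finally have "ennreal (t powr p * tail M f t) \<le> ennreal ((K * \<psi> p) powr p)"
    using I by (simp add: tail_def emeasure_eq_measure ennreal_mult)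
  then have "t powr p * tail M f t \<le> (K * \<psi> p) powr p"
    by simp
  then show ?thesis
    using t \<psi> \<open>K \<ge> 0\<close> by (simp add: powr_divide field_simps)
qed

text \<open>The exponent may depend on \<open>u\<close>, but \<open>B\<close> may not: a uniform
  \<open>B\<close> can be absorbed by one rescaling of \<open>t\<close>, the same for all functions.
  Three ranges of \<open>u\<close> are treated: the quadratic branch, a bounded range of
  \<open>ln u\<close>, and the rest.\<close>

lemma Phi_times_psi_bounded:
  assumes "p0 > 1" and "\<Delta> \<ge> 0"
    and cont: "continuous_on {1..} S" and pos: "\<And>x. x \<ge> 1 \<Longrightarrow> S x > 0"
    and sv: "slowly_varying S"
  obtains B where
    "\<And>u. u > 0 \<Longrightarrow> \<exists>p\<in>{1..<p0}. Phi p0 (\<Delta> + 1) S u * (psi p0 \<Delta> S p / u) powr p \<le> B"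
proof -
  obtain E where "E \<ge> 0" and E: "\<And>x. x \<ge> 1 \<Longrightarrow> exp (- E * x) \<le> S x"
    using slowly_varying_exp_lower_bound[OF cont pos sv] by blast
  define \<psi>1 where "\<psi>1 = psi p0 \<Delta> S 1"
  have \<psi>1: "\<psi>1 > 0"
    unfolding \<psi>1_def using pos \<open>p0 > 1\<close> by (intro psi_pos) auto
  \<comment> \<open>For positive \<open>L\<close>, the exponent \<open>p0 * (1 - 1 / L)\<close> is
    at least 1 exactly when \<open>L\<close> is at least \<open>L0\<close>; below this threshold the
    exponent 1 serves instead.\<close>
  define L0 where "L0 = p0 / (p0 - 1)"
  define B1 B2 B3 where "B1 = Phi_const p0 S * exp 1 * \<psi>1"
    and "B2 = exp (p0 * L0) * exp (E * L0) * \<psi>1" and "B3 = exp p0 * exp E"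
  have C0: "Phi_const p0 S > 0"
    using pos[of 1] by (simp add: Phi_const_def)
  have bound: "\<exists>p\<in>{1..<p0}. Phi p0 (\<Delta> + 1) S u * (psi p0 \<Delta> S p / u) powr p \<le> Max {B1, B2, B3}"
    if u: "u > 0" for u
  proof -
    define L where "L = ln u"
    have uL: "u = exp L"
      using u by (simp add: L_def)
    consider "u < exp 1" | "u \<ge> exp 1" "L \<le> L0" | "u \<ge> exp 1" "L > L0" by linarith
    then show ?thesis
    proof cases
      case 1
      have "Phi p0 (\<Delta> + 1) S u * (psi p0 \<Delta> S 1 / u) powr 1 = Phi_const p0 S * u * \<psi>1"
        using 1 u \<psi>1 by (simp add: Phi_def \<psi>1_def[symmetric] power2_eq_square)
      also have "\<dots> \<le> B1"
        unfolding B1_def using 1 C0 \<psi>1 by (intro mult_right_mono mult_left_mono) auto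
      finally show ?thesis
        using \<open>p0 > 1\<close> by (intro bexI[of _ 1]) auto
    next
      case 2
      have "L \<ge> 1"
        using 2(1) by (simp add: uL)
      have "Phi p0 (\<Delta> + 1) S u = exp (p0 * L) * L powr (- (\<Delta> + 1)) * (1 / S L)"
        using 2 by (simp add: Phi_def uL exp_powr_real mult.commute)
      \<comment> \<open>On this bounded range every factor is estimated separately; the exponential
        lower bound for \<open>S\<close> also controls \<open>1 / S L\<close> here.\<close>
      also have "\<dots> \<le> exp (p0 * L0) * 1 * exp (E * L0)"
      proof (intro mult_mono)
        show "exp (p0 * L) \<le> exp (p0 * L0)"
          using 2 \<open>p0 > 1\<close> by simp
        show "L powr (- (\<Delta> + 1)) \<le> 1"
          using \<open>L \<ge> 1\<close> \<open>\<Delta> \<ge> 0\<close> powr_mono[of "- (\<Delta> + 1)" 0 L] by simp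
        have "1 / S L \<le> 1 / exp (- E * L)"
          using E[OF \<open>L \<ge> 1\<close>] pos[OF \<open>L \<ge> 1\<close>] by (intro divide_left_mono) auto
        also have "\<dots> = exp (E * L)"
          by (simp add: exp_minus field_simps)
        also have "\<dots> \<le> exp (E * L0)"
          using 2 \<open>E \<ge> 0\<close> by (simp add: mult_left_mono)
        finally show "1 / S L \<le> exp (E * L0)" .
      qed (use pos[OF \<open>L \<ge> 1\<close>] in auto)
      finally have "Phi p0 (\<Delta> + 1) S u \<le> exp (p0 * L0) * exp (E * L0)"
        by simp
      moreover have "(psi p0 \<Delta> S 1 / u) powr 1 \<le> \<psi>1"
      proof -
        have "u \<ge> 1"
          using \<open>L \<ge> 1\<close> by (simp add: uL)
        then show ?thesis
          using \<psi>1 u by (simp add: \<psi>1_def[symmetric] divide_le_eq)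
      qed
      ultimately have "Phi p0 (\<Delta> + 1) S u * (psi p0 \<Delta> S 1 / u) powr 1 \<le> B2"
        unfolding B2_def by (intro mult_mono) auto
      then show ?thesis
        using \<open>p0 > 1\<close> by (intro bexI[of _ 1]) auto
    next
      case 3
      have "L \<ge> 1"
        using 3(1) by (simp add: uL)
      define p where "p = p0 * (1 - 1 / L)"
      have "p0 - 1 \<ge> p0 / L"
        using 3(2) \<open>L \<ge> 1\<close> \<open>p0 > 1\<close> by (simp add: L0_def field_simps)
      then have p: "p \<in> {1..<p0}"
        using \<open>L \<ge> 1\<close> \<open>p0 > 1\<close> by (simp add: p_def field_simps)
      have SL: "S L > 0"
        using pos \<open>L \<ge> 1\<close> by simp
      have gap: "p0 - p = p0 / L" "p0 / (p0 - p) = L" "p / p0 = 1 - 1 / L"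
        using \<open>L \<ge> 1\<close> \<open>p0 > 1\<close> by (auto simp: p_def field_simps)
      have \<psi>: "psi p0 \<Delta> S p > 0"
        using psi_pos pos p by auto
      have ln_\<psi>: "ln (psi p0 \<Delta> S p) = - (1 + \<Delta>) / p0 * (ln p0 - ln L) + 1 / p0 * ln (S L)"
        unfolding psi_def gap(2) unfolding gap(1)
        using SL \<open>L \<ge> 1\<close> \<open>p0 > 1\<close> by (simp add: ln_mult ln_powr ln_div)
      have Phi: "Phi p0 (\<Delta> + 1) S u = exp (p0 * L - (\<Delta> + 1) * ln L - ln (S L))"
        using 3 \<open>L \<ge> 1\<close> SL
        by (simp add: Phi_def uL exp_powr_real exp_diff powr_def exp_minus exp_add field_simps)
      have ratio: "(psi p0 \<Delta> S p / u) powr p = exp (p * (ln (psi p0 \<Delta> S p) - L))"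
        using \<psi> u by (simp add: powr_def ln_div L_def)
      have "p * ln (psi p0 \<Delta> S p) = p / p0 * (- (1 + \<Delta>) * (ln p0 - ln L) + ln (S L))"
        using \<open>p0 > 1\<close> by (simp add: ln_\<psi> field_simps)
      \<comment> \<open>The left side is the logarithm of the product to be bounded. Since
        \<open>p / p0\<close> is \<open>1 - 1 / L\<close>, the terms in \<open>ln L\<close> and
        \<open>ln (S L)\<close> cancel up to remainders divided by \<open>L\<close>; for
        \<open>ln L\<close> this relies on the exponent \<open>\<Delta> + 1\<close> in
        \<open>Phi\<close>. The choice of \<open>p\<close> also turns \<open>(p0 - p) * L\<close>
        into \<open>p0\<close>.\<close>
      then have "p0 * L - (\<Delta> + 1) * ln L - ln (S L) + p * (ln (psi p0 \<Delta> S p) - L)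
          = (p0 - p) * L - (\<Delta> + 1) * ln L - ln (S L)
            + (1 - 1 / L) * (- (1 + \<Delta>) * (ln p0 - ln L) + ln (S L))"
        by (simp add: gap(3) algebra_simps)
      also have "\<dots> = p0 - (1 - 1 / L) * (1 + \<Delta>) * ln p0 - (1 + \<Delta>) * ln L / L - ln (S L) / L"
        using \<open>L \<ge> 1\<close> by (simp add: gap(1) field_simps)
      also have "\<dots> \<le> p0 - ln (S L) / L"
      proof -
        have "(1 - 1 / L) * (1 + \<Delta>) * ln p0 \<ge> 0" "(1 + \<Delta>) * ln L / L \<ge> 0"
          using \<open>L \<ge> 1\<close> \<open>p0 > 1\<close> \<open>\<Delta> \<ge> 0\<close> by auto
        then show ?thesis by linarith
      qed
      also have "\<dots> \<le> p0 + E"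
      proof -
        have "- E * L \<le> ln (S L)"
          using E[OF \<open>L \<ge> 1\<close>] SL by (simp add: ln_ge_iff)
        then show ?thesis
          using \<open>L \<ge> 1\<close> by (simp add: field_simps)
      qed
      finally have "Phi p0 (\<Delta> + 1) S u * (psi p0 \<Delta> S p / u) powr p \<le> B3"
        unfolding Phi ratio B3_def by (simp flip: exp_add)
      then show ?thesis
        using p by (intro bexI[of _ p]) auto
    qed
  qed
  show thesis
    by (rule that) (rule bound)
qed

theorem theorem4p2:
  fixes M :: "'a measure" and p0 \<Delta> :: real and S :: "real \<Rightarrow> real"
  assumes "prob_space M"
    and "p0 > 1" and "\<Delta> \<ge> 0"
    and "continuous_on {1..} S" and "\<And>x. x \<ge> 1 \<Longrightarrow> S x > 0"
    and "slowly_varying S"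
  shows "continuously_embedded
    (grand_lebesgue_space M p0 (psi p0 \<Delta> S)) (grand_lebesgue_norm M p0 (psi p0 \<Delta> S))
    (weak_orlicz_space M (Phi p0 (\<Delta> + 1) S)) (weak_orlicz_norm M (Phi p0 (\<Delta> + 1) S))"
proof -
  interpret prob_space M by fact
  let ?\<psi> = "psi p0 \<Delta> S" and ?\<Phi> = "Phi p0 (\<Delta> + 1) S"
  obtain B where B: "\<And>u. u > 0 \<Longrightarrow> \<exists>p\<in>{1..<p0}. ?\<Phi> u * (?\<psi> p / u) powr p \<le> B"
    using Phi_times_psi_bounded[OF assms(2-6)] by blast
  \<comment> \<open>With \<open>C\<close> at least 1 and \<open>p\<close> at least 1,
    \<open>C powr p\<close> is at least \<open>C\<close>, so dividing by it absorbs \<open>B\<close>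
    whichever exponent \<open>p\<close> was chosen.\<close>
  define C where "C = max B 1"
  have C: "C \<ge> 1" "C \<ge> B"
    by (auto simp: C_def)
  have Phi_nonneg: "?\<Phi> u \<ge> 0" if "u > 0" for u
  proof (cases "u \<ge> exp 1")
    case True
    then have "ln u \<ge> 1"
      using that by (simp add: ln_ge_iff)
    then show ?thesis
      using assms(5)[of "ln u"] that True by (simp add: Phi_def)
  next
    case False
    then show ?thesis
      using assms(5)[of 1] that by (simp add: Phi_def Phi_const_def)
  qed
  \<comment> \<open>Strict positivity of \<open>K\<close> makes \<open>C * K\<close> an admissible
    scale in the infimum defining the weak norm.\<close>
  have scaled: "weak_orlicz_norm M ?\<Phi> f \<le> ennreal (C * K)"
    if f: "f \<in> borel_measurable M" and K: "K > 0" "grand_lebesgue_norm M p0 ?\<psi> f \<le> ennreal K"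
    for f K
  proof -
    have "?\<Phi> (t / (C * K)) * tail M f t \<le> 1" if t: "t > 0" for t
    proof -
      define u where "u = t / (C * K)"
      have u: "u > 0" "t = u * (C * K)"
        using t C K by (auto simp: u_def)
      obtain p where p: "p \<in> {1..<p0}" and bound: "?\<Phi> u * (?\<psi> p / u) powr p \<le> B"
        using B u(1) by blast
      have \<psi>: "?\<psi> p > 0"
        using p assms(5) by (intro psi_pos) auto
      have "K * ?\<psi> p / t = ?\<psi> p / u / C"
        using u C K by (simp add: field_simps)
      then have "tail M f t \<le> (?\<psi> p / u / C) powr p"
        using tail_le_grand_lebesgue_norm[OF finite_measure_axioms f K(2) _ p \<psi> t] K(1) by simp
      also have "\<dots> = (?\<psi> p / u) powr p / C powr p"
        using \<psi> u C by (simp add: powr_divide powr_mult)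
      also have "\<dots> \<le> (?\<psi> p / u) powr p / C"
        using C p powr_mono[of 1 p C] by (intro divide_left_mono) auto
      finally have "?\<Phi> u * tail M f t \<le> ?\<Phi> u * ((?\<psi> p / u) powr p / C)"
        using Phi_nonneg u by (intro mult_left_mono) auto
      also have "\<dots> \<le> 1"
        using bound C by (simp add: divide_le_eq)
      finally show ?thesis
        by (simp add: u_def)
    qed
    then have "(SUP t \<in> {0<..}. ennreal (?\<Phi> (t / (C * K)) * tail M f t)) \<le> 1"
      by (intro SUP_least) auto
    then show ?thesis
      unfolding weak_orlicz_norm_def using C K by (intro INF_lower) auto
  qed
  have embed: "weak_orlicz_norm M ?\<Phi> f \<le> ennreal C * grand_lebesgue_norm M p0 ?\<psi> f"
    if "f \<in> grand_lebesgue_space M p0 ?\<psi>" for f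
  proof -
    from that have f: "f \<in> borel_measurable M" and "grand_lebesgue_norm M p0 ?\<psi> f < \<top>"
      by (auto simp: grand_lebesgue_space_def)
    then obtain k where k: "k \<ge> 0" "grand_lebesgue_norm M p0 ?\<psi> f = ennreal k"
      by (metis ennreal_cases less_top)
    \<comment> \<open>The norm may vanish, so the scaled bound is used with values slightly above it.\<close>
    have "weak_orlicz_norm M ?\<Phi> f \<le> ennreal (C * k)"
    proof (rule ennreal_le_epsilon)
      fix e :: real
      assume "e > 0"
      \<comment> \<open>The increment \<open>e / C\<close> is chosen so that multiplication by
        \<open>C\<close> leaves an error of exactly \<open>e\<close>.\<close>
      then have "weak_orlicz_norm M ?\<Phi> f \<le> ennreal (C * (k + e / C))"
        using C k by (intro scaled f) (auto intro!: add_nonneg_pos ennreal_leI)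
      also have "\<dots> = ennreal (C * k) + ennreal e"
        using C k \<open>e > 0\<close> by (simp add: field_simps flip: ennreal_plus)
      finally show "weak_orlicz_norm M ?\<Phi> f \<le> ennreal (C * k) + ennreal e" .
    qed
    then show ?thesis
      using C k by (simp add: ennreal_mult)
  qed
  have "f \<in> weak_orlicz_space M ?\<Phi>" if "f \<in> grand_lebesgue_space M p0 ?\<psi>" for f
  proof -
    have "ennreal C * grand_lebesgue_norm M p0 ?\<psi> f < \<top>"
      using that by (simp add: grand_lebesgue_space_def ennreal_mult_less_top)
    then have "weak_orlicz_norm M ?\<Phi> f < \<top>"
      using embed[OF that] by (rule le_less_trans[rotated])
    then show ?thesis
      using that by (simp add: grand_lebesgue_space_def weak_orlicz_space_def)
  qed
  then show ?thesis
    unfolding continuously_embedded_def using embed by (auto intro!: exI[of _ "ennreal C"])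
qed

end
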